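(* Let $\mathcal P=\{\mathrm{FIFO},\mathrm{LIFO},\mathrm{RANDOM},[h,\mathrm{FIFO}],[h,\mathrm{LIFO}],[h,\mathrm{RANDOM}],[-h,\mathrm{FIFO}],[-h,\mathrm{LIFO}],[-h,\mathrm{RANDOM}]\}$ be the nine A* tie-breaking strategies defined in the context. Then for every integer $M\ge 1$, within the class of star instances with parameter $M$ (positive-cost trees, defined in the context): (i) For every ordered pair $(\tau_1,\tau_2)$ of distinct deterministic strategies in $\mathcal P$ there is a star instance $I$ with parameter $M$ such that $X_{\tau_1}(I)=2$ and $X_{\tau_2}(I)=M+2$. (Thus each unordered pair has an instance with expansion counts $2$ and $M+2$ and another with these counts reversed.) (ii) For every ordered pair $(\tau_1,\tau_2)$ of distinct strategies in $\mathcal P$ at least one of which is randomized, there is a star instance $I$ with parameter $M$ such that $\mathbb E[X_{\tau_2}(I)]-\mathbb E[X_{\tau_1}(I)]\ge M/2$. All comparisons are decided before an optimal goal is generated: in these instances the selections that produce the difference in expansion counts all take place before the goal $G$ has been generated.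
   Context: **Search instances.** A search instance is $I=(V,A,c,s,\mathcal G,h)$ with $(V,A)$ a finite directed graph, $c:A\to\mathbb R_{\ge0}$ edge costs, $s\notin\mathcal G$ the initial state, $\mathcal G\subseteq V$ the goals, $h:V\to\mathbb R$ a heuristic, together with a fixed order in which the successors of each state are generated (part of the instance). **A\* model.** Initially OPEN contains only $s$ with $g(s)=0$, and CLOSED is empty. Each OPEN entry stores its best known $g$-value, parent, first-insertion timestamp and goal status. At a selection point let $\mathrm{OPEN}_{\min}$ be the set of $v\in\mathrm{OPEN}$ minimizing $f(v)=g(v)+h(v)$. If $\mathrm{OPEN}_{\min}$ contains a goal, a goal is selected and the search terminates (goal preference; selecting a goal is not an expansion). Otherwise the tie-breaker selects a non-goal in $\mathrm{OPEN}_{\min}$, which is expanded: it is moved from OPEN to CLOSED and all its successors are generated in the given order. A newly encountered state is inserted into OPEN; a strictly smaller tentative $g$ updates an existing OPEN entry's $g$ and parent but keeps its first-insertion timestamp; equal- and higher-cost duplicates are discarded. (With a consistent heuristic no state is ever reopened.) **Tie-breaking.** FIFO (LIFO) selects the candidate with the earliest (latest) first-insertion timestamp. RANDOM selects uniformly at random among the candidates, independently at each selection. The strategies FIFO, LIFO, RANDOM apply this to the non-goals in $\mathrm{OPEN}_{\min}$. For $\tau\in\{\mathrm{FIFO},\mathrm{LIFO},\mathrm{RANDOM}\}$, $[h,\tau]$ first restricts to the states of $\mathrm{OPEN}_{\min}$ of minimum $h$ and then applies $\tau$; $[-h,\tau]$ first restricts to those of maximum $h$ and then applies $\tau$. A strategy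 is deterministic if it does not use RANDOM and randomized otherwise. **Counts.** $X_\tau(I)$ is the number of non-goal states expanded by strategy $\tau$ on $I$ (a random variable for randomized strategies; expectation is over the strategy's random choices on the fixed instance). **Star instance with parameter $M$.** Choose $C>0$, values $0<h(u)<C$ for $u\in U=\{p,b_1,\dots,b_M\}$, and an order on $U$. The instance is the tree with states $\{s,G\}\cup U$, initial state $s$, unique goal $G$, edges $s\to u$ for all $u\in U$ and one further edge $p\to G$, with $h(s)=C$, $h(G)=0$, $c(s,u)=C-h(u)$ for $u\in U$, $c(p,G)=h(p)$; the successors of $s$ are generated in the chosen order on $U$. *)

theory Defs
  imports "HOL-Probability.Probability"
begin

section \<open>Search instances\<close>

record 'v search_instance =
  states :: "'v set"
  edges  :: "('v \<times> 'v) set"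
  cost   :: "'v \<times> 'v \<Rightarrow> real"
  start  :: 'v
  goals  :: "'v set"
  heur   :: "'v \<Rightarrow> real"
  succs  :: "'v \<Rightarrow> 'v list"  \<comment> \<open>successors in the order in which they are generated\<close>

definition search_instance :: "'v search_instance \<Rightarrow> bool" where
  "search_instance I \<longleftrightarrow>
     finite (states I) \<and> edges I \<subseteq> states I \<times> states I \<and>
     (\<forall>e\<in>edges I. 0 \<le> cost I e) \<and>
     start I \<in> states I \<and> start I \<notin> goals I \<and> goals I \<subseteq> states I \<and>
     (\<forall>v\<in>states I. distinct (succs I v) \<and> set (succs I v) = {w. (v, w) \<in> edges I})"

definition consistent :: "'v search_instance \<Rightarrow> bool" where
  "consistent I \<longleftrightarrow>
     (\<forall>(v, w)\<in>edges I. heur I v \<le> cost I (v, w) + heur I w) \<and> (\<forall>v\<in>goals I. heur I v = 0)"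


section \<open>The A* model\<close>

record 'v open_entry =
  gval    :: real
  parent  :: "'v option"
  stamp   :: nat   \<comment> \<open>first-insertion timestamp\<close>
  is_goal :: bool

record 'v config =
  OPEN       :: "'v \<Rightarrow> 'v open_entry option"
  CLOSED     :: "'v set"
  clock      :: nat   \<comment> \<open>number of insertions into OPEN so far, i.e. the next timestamp\<close>
  expansions :: nat

definition entry :: "'v config \<Rightarrow> 'v \<Rightarrow> 'v open_entry" where
  "entry \<sigma> v = the (OPEN \<sigma> v)"

definition initial :: "'v search_instance \<Rightarrow> 'v config" where
  "initial I =
     \<lparr>OPEN = [start I \<mapsto> \<lparr>gval = 0, parent = None, stamp = 0, is_goal = (start I \<in> goals I)\<rparr>],
      CLOSED = {}, clock = 1, expansions = 0\<rparr>"

text \<open>A state on CLOSED is never reopened, so a duplicate of it is always discarded. For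
  consistent heuristics such a duplicate never has a smaller \<open>g\<close>-value.\<close>

definition generate ::
  "'v search_instance \<Rightarrow> 'v \<Rightarrow> real \<Rightarrow> 'v \<Rightarrow> 'v config \<Rightarrow> 'v config" where
  "generate I v gv w \<sigma> =
     (let g' = gv + cost I (v, w) in
      if w \<in> CLOSED \<sigma> then \<sigma>
      else case OPEN \<sigma> w of
        None \<Rightarrow> \<sigma>\<lparr>OPEN := (OPEN \<sigma>)(w \<mapsto> \<lparr>gval = g', parent = Some v,
                                        stamp = clock \<sigma>, is_goal = (w \<in> goals I)\<rparr>),
                  clock := Suc (clock \<sigma>)\<rparr>
      | Some e \<Rightarrow> if g' < gval e
                  then \<sigma>\<lparr>OPEN := (OPEN \<sigma>)(w \<mapsto> e\<lparr>gval := g', parent := Some v\<rparr>)\<rparr>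
                  else \<sigma>)"

definition expand :: "'v search_instance \<Rightarrow> 'v \<Rightarrow> 'v config \<Rightarrow> 'v config" where
  "expand I v \<sigma> =
     fold (generate I v (gval (entry \<sigma> v))) (succs I v)
       (\<sigma>\<lparr>OPEN := (OPEN \<sigma>)(v := None), CLOSED := insert v (CLOSED \<sigma>),
          expansions := Suc (expansions \<sigma>)\<rparr>)"

definition fval :: "'v search_instance \<Rightarrow> 'v config \<Rightarrow> 'v \<Rightarrow> real" where
  "fval I \<sigma> v = gval (entry \<sigma> v) + heur I v"

definition open_min :: "'v search_instance \<Rightarrow> 'v config \<Rightarrow> 'v set" where
  "open_min I \<sigma> = {v \<in> dom (OPEN \<sigma>). \<forall>w\<in>dom (OPEN \<sigma>). fval I \<sigma> v \<le> fval I \<sigma> w}"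

text \<open>The search stops when a goal is selected (goal preference) or OPEN is exhausted.\<close>

definition finished :: "'v search_instance \<Rightarrow> 'v config \<Rightarrow> bool" where
  "finished I \<sigma> \<longleftrightarrow> dom (OPEN \<sigma>) = {} \<or> (\<exists>v\<in>open_min I \<sigma>. is_goal (entry \<sigma> v))"

definition candidates :: "'v search_instance \<Rightarrow> 'v config \<Rightarrow> 'v set" where
  "candidates I \<sigma> = {v \<in> open_min I \<sigma>. \<not> is_goal (entry \<sigma> v)}"


section \<open>Tie-breaking\<close>

datatype base_rule = FIFO | LIFO | RANDOM

text \<open>The nine strategies: \<open>\<tau>\<close>, \<open>[h, \<tau>]\<close> and \<open>[-h, \<tau>]\<close> for a base rule \<open>\<tau>\<close>.\<close>

datatype strategy = Plain base_rule | MinH base_rule | MaxH base_rule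

lemma UNIV_strategy:
  "(UNIV :: strategy set) =
     {Plain FIFO, Plain LIFO, Plain RANDOM, MinH FIFO, MinH LIFO, MinH RANDOM,
      MaxH FIFO, MaxH LIFO, MaxH RANDOM}"
proof -
  have "(\<tau> :: strategy) \<in> {Plain FIFO, Plain LIFO, Plain RANDOM, MinH FIFO, MinH LIFO, MinH RANDOM,
      MaxH FIFO, MaxH LIFO, MaxH RANDOM}" for \<tau>
    by (cases \<tau>; rename_tac b; case_tac b) auto
  then show ?thesis by blast
qed

fun base_of :: "strategy \<Rightarrow> base_rule" where
  "base_of (Plain b) = b"
| "base_of (MinH b) = b"
| "base_of (MaxH b) = b"

definition deterministic :: "strategy \<Rightarrow> bool" where
  "deterministic \<tau> \<longleftrightarrow> base_of \<tau> \<noteq> RANDOM"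

definition randomized :: "strategy \<Rightarrow> bool" where
  "randomized \<tau> \<longleftrightarrow> base_of \<tau> = RANDOM"

fun restrict_cands :: "strategy \<Rightarrow> ('v \<Rightarrow> real) \<Rightarrow> 'v set \<Rightarrow> 'v set" where
  "restrict_cands (Plain b) h S = S"
| "restrict_cands (MinH b) h S = {v \<in> S. \<forall>w\<in>S. h v \<le> h w}"
| "restrict_cands (MaxH b) h S = {v \<in> S. \<forall>w\<in>S. h w \<le> h v}"

fun base_select :: "base_rule \<Rightarrow> 'v config \<Rightarrow> 'v set \<Rightarrow> 'v pmf" where
  "base_select FIFO \<sigma> S = return_pmf (arg_min_on (\<lambda>v. stamp (entry \<sigma> v)) S)"
| "base_select LIFO \<sigma> S = return_pmf (arg_max_on (\<lambda>v. stamp (entry \<sigma> v)) S)"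
| "base_select RANDOM \<sigma> S = pmf_of_set S"

definition select :: "strategy \<Rightarrow> 'v search_instance \<Rightarrow> 'v config \<Rightarrow> 'v pmf" where
  "select \<tau> I \<sigma> = base_select (base_of \<tau>) \<sigma> (restrict_cands \<tau> (heur I) (candidates I \<sigma>))"


section \<open>Runs and expansion counts\<close>

definition step :: "strategy \<Rightarrow> 'v search_instance \<Rightarrow> 'v config \<Rightarrow> 'v config pmf" where
  "step \<tau> I \<sigma> =
     (if finished I \<sigma> then return_pmf \<sigma>
      else map_pmf (\<lambda>v. expand I v \<sigma>) (select \<tau> I \<sigma>))"

primrec run :: "strategy \<Rightarrow> 'v search_instance \<Rightarrow> nat \<Rightarrow> 'v config pmf" where
  "run \<tau> I 0 = return_pmf (initial I)"
| "run \<tau> I (Suc n) = bind_pmf (run \<tau> I n) (step \<tau> I)"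

text \<open>The distribution of the number of expanded non-goal states (only non-goals are ever
  expanded). After \<open>card (states I)\<close> steps every run has finished, see
  \<open>run_finished\<close> below. For a deterministic strategy this is a point mass.\<close>

definition num_expanded :: "strategy \<Rightarrow> 'v search_instance \<Rightarrow> nat pmf" where
  "num_expanded \<tau> I = map_pmf expansions (run \<tau> I (card (states I)))"

definition expected_expanded :: "strategy \<Rightarrow> 'v search_instance \<Rightarrow> real" where
  "expected_expanded \<tau> I = measure_pmf.expectation (num_expanded \<tau> I) real"

text \<open>At every selection point of every possible run at which a state is expanded (rather than
  a goal selected), no goal has been generated yet.\<close>

definition decided_before_goal :: "strategy \<Rightarrow> 'v search_instance \<Rightarrow> bool" where
  "decided_before_goal \<tau> I \<longleftrightarrow>
     (\<forall>n. \<forall>\<sigma>\<in>set_pmf (run \<tau> I n). \<not> finished I \<sigma> \<longrightarrow>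
        goals I \<inter> (dom (OPEN \<sigma>) \<union> CLOSED \<sigma>) = {})"


section \<open>Every run finishes within \<open>card (states I)\<close> steps\<close>

definition config_inv :: "'v search_instance \<Rightarrow> nat \<Rightarrow> 'v config \<Rightarrow> bool" where
  "config_inv I n \<sigma> \<longleftrightarrow>
     dom (OPEN \<sigma>) \<subseteq> states I \<and> CLOSED \<sigma> \<subseteq> states I \<and> dom (OPEN \<sigma>) \<inter> CLOSED \<sigma> = {} \<and>
     card (CLOSED \<sigma>) = n \<and> expansions \<sigma> = n"

lemma config_inv_generate:
  assumes "config_inv I n \<sigma>" "w \<in> states I"
  shows "config_inv I n (generate I v gv w \<sigma>)"
  using assms by (auto simp: config_inv_def generate_def Let_def split: option.splits)

lemma config_inv_fold:
  assumes "config_inv I n \<sigma>" "set ws \<subseteq> states I"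
  shows "config_inv I n (fold (generate I v gv) ws \<sigma>)"
  using assms by (induction ws arbitrary: \<sigma>) (auto simp: config_inv_generate)

lemma config_inv_expand:
  assumes I: "search_instance I" and inv: "config_inv I n \<sigma>" and v: "v \<in> dom (OPEN \<sigma>)"
  shows "config_inv I (Suc n) (expand I v \<sigma>)"
  unfolding expand_def
proof (rule config_inv_fold)
  have "finite (CLOSED \<sigma>)"
    using I inv by (auto simp: search_instance_def config_inv_def intro: finite_subset)
  then show "config_inv I (Suc n)
      (\<sigma>\<lparr>OPEN := (OPEN \<sigma>)(v := None), CLOSED := insert v (CLOSED \<sigma>),
          expansions := Suc (expansions \<sigma>)\<rparr>)"
    using inv v by (auto simp: config_inv_def card_insert_if)
  show "set (succs I v) \<subseteq> states I"
    using I inv v unfolding search_instance_def config_inv_def by blast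
qed

lemma set_select:
  assumes "finite (dom (OPEN \<sigma>))" "\<not> finished I \<sigma>"
  shows "set_pmf (select \<tau> I \<sigma>) \<subseteq> candidates I \<sigma>"
proof -
  let ?C = "candidates I \<sigma>" and ?R = "restrict_cands \<tau> (heur I) (candidates I \<sigma>)"
  have ne: "dom (OPEN \<sigma>) \<noteq> {}" using assms by (auto simp: finished_def)
  have "open_min I \<sigma> \<noteq> {}"
    using arg_min_if_finite[OF assms(1) ne, of "fval I \<sigma>"]
    by (force simp: open_min_def not_less)
  then have Cne: "?C \<noteq> {}" using assms by (auto simp: finished_def candidates_def)
  have Cfin: "finite ?C"
    using assms(1) by (rule rev_finite_subset) (auto simp: candidates_def open_min_def)
  have Rsub: "?R \<subseteq> ?C" by (cases \<tau>) auto
  then have Rfin: "finite ?R" using Cfin finite_subset by blast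
  have Rne: "?R \<noteq> {}"
  proof (cases \<tau>)
    case (MinH b)
    then show ?thesis using arg_min_if_finite[OF Cfin Cne, of "heur I"]
      by (force simp: not_less)
  next
    case (MaxH b)
    then show ?thesis using arg_min_if_finite[OF Cfin Cne, of "\<lambda>v. - heur I v"]
      by (force simp: not_less)
  qed (use Cne in simp)
  have "arg_max_on f ?R \<in> ?R" for f :: "'a \<Rightarrow> nat"
  proof -
    have fin: "finite (f ` ?R)" using Rfin by simp
    obtain k where k: "k \<in> ?R" using Rne by blast
    have "\<forall>y. y \<in> ?R \<longrightarrow> f y < Suc (Max (f ` ?R))"
      using Rfin by (simp add: le_imp_less_Suc)
    from arg_max_natI[of "\<lambda>x. x \<in> ?R", OF k this] show ?thesis
      unfolding arg_max_on_def .
  qed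
  then show ?thesis
    using Rsub Rfin Rne arg_min_if_finite(1)[OF Rfin Rne]
    by (cases "base_of \<tau>") (auto simp: select_def)
qed

lemma run_inv:
  assumes I: "search_instance I" and "\<sigma> \<in> set_pmf (run \<tau> I n)"
  shows "\<exists>k\<le>n. config_inv I k \<sigma> \<and> (k = n \<or> finished I \<sigma>)"
  using assms(2)
proof (induction n arbitrary: \<sigma>)
  case 0
  then show ?case using I by (auto simp: initial_def config_inv_def search_instance_def)
next
  case (Suc n)
  then obtain \<rho> where \<rho>: "\<rho> \<in> set_pmf (run \<tau> I n)" "\<sigma> \<in> set_pmf (step \<tau> I \<rho>)"
    by (auto simp: set_bind_pmf)
  from Suc.IH[OF \<rho>(1)] obtain k where
    k: "k \<le> n" "config_inv I k \<rho>" "k = n \<or> finished I \<rho>" by blast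
  show ?case
  proof (cases "finished I \<rho>")
    case True
    then have "\<sigma> = \<rho>" using \<rho>(2) by (simp add: step_def)
    with True k(1,2) show ?thesis by (intro exI[of _ k]) simp
  next
    case False
    have "finite (dom (OPEN \<rho>))"
      using I k(2) by (auto simp: search_instance_def config_inv_def intro: finite_subset)
    from set_select[OF this False] \<rho>(2) False obtain v where
      "v \<in> candidates I \<rho>" "\<sigma> = expand I v \<rho>" by (auto simp: step_def)
    moreover from this have "v \<in> dom (OPEN \<rho>)" by (simp add: candidates_def open_min_def)
    ultimately have "config_inv I (Suc k) \<sigma>" using config_inv_expand[OF I k(2)] by simp
    moreover have "k = n" using k(3) False by simp
    ultimately show ?thesis by (intro exI[of _ "Suc n"]) simp
  qed
qed

lemma run_finished:
  assumes I: "search_instance I" and "\<sigma> \<in> set_pmf (run \<tau> I (card (states I)))"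
  shows "finished I \<sigma>"
proof (rule ccontr)
  assume nf: "\<not> finished I \<sigma>"
  with run_inv[OF assms] have inv: "config_inv I (card (states I)) \<sigma>" by blast
  have "finite (states I)" using I by (simp add: search_instance_def)
  then have "CLOSED \<sigma> = states I"
    using inv by (intro card_subset_eq) (simp_all add: config_inv_def)
  with inv have "dom (OPEN \<sigma>) = {}" by (auto simp: config_inv_def)
  with nf show False by (simp add: finished_def)
qed

lemma num_expanded_bounded:
  assumes "search_instance I" "k \<in> set_pmf (num_expanded \<tau> I)"
  shows "k \<le> card (states I)"
proof -
  obtain \<sigma> where "\<sigma> \<in> set_pmf (run \<tau> I (card (states I)))" "k = expansions \<sigma>"
    using assms(2) by (auto simp: num_expanded_def)
  with run_inv[OF assms(1) this(1)] show ?thesis by (auto simp: config_inv_def)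
qed

lemma integrable_num_expanded:
  assumes "search_instance I"
  shows "integrable (measure_pmf (num_expanded \<tau> I)) real"
proof (rule integrable_measure_pmf_finite)
  have "set_pmf (num_expanded \<tau> I) \<subseteq> {..card (states I)}"
    using num_expanded_bounded[OF assms] by blast
  then show "finite (set_pmf (num_expanded \<tau> I))"
    by (rule finite_subset) simp
qed


section \<open>Star instances\<close>

datatype star_state = St_s | St_G | St_p | St_b nat

definition star_U :: "nat \<Rightarrow> star_state set" where
  "star_U M = insert St_p (St_b ` {1..M})"

text \<open>The values of \<open>hU\<close> outside \<open>star_U M\<close> and the costs outside the edge set are irrelevant.\<close>

definition star_instance ::
  "nat \<Rightarrow> real \<Rightarrow> (star_state \<Rightarrow> real) \<Rightarrow> star_state list \<Rightarrow> star_state search_instance" where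
  "star_instance M C hU us =
     \<lparr>states = {St_s, St_G} \<union> star_U M,
      edges = ({St_s} \<times> star_U M) \<union> {(St_p, St_G)},
      cost = (\<lambda>(v, w). if v = St_s then C - hU w else hU v),
      start = St_s,
      goals = {St_G},
      heur = (\<lambda>v. if v = St_s then C else if v = St_G then 0 else hU v),
      succs = (\<lambda>v. if v = St_s then us else if v = St_p then [St_G] else [])\<rparr>"

definition star_instances :: "nat \<Rightarrow> star_state search_instance set" where
  "star_instances M =
     {star_instance M C hU us | C hU us.
        0 < C \<and> (\<forall>u\<in>star_U M. 0 < hU u \<and> hU u < C) \<and> distinct us \<and> set us = star_U M}"

lemma star_instances_sound:
  assumes "I \<in> star_instances M"
  shows "search_instance I" "consistent I" "\<forall>e\<in>edges I. 0 < cost I e"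
proof -
  obtain C hU us where I: "I = star_instance M C hU us" and C: "0 < C"
    and h: "\<And>u. u \<in> star_U M \<Longrightarrow> 0 < hU u \<and> hU u < C"
    and us: "distinct us" "set us = star_U M"
    using assms unfolding star_instances_def by blast
  have p: "St_p \<in> star_U M" and notU: "St_s \<notin> star_U M" "St_G \<notin> star_U M"
    and fin: "finite (star_U M)"
    by (auto simp: star_U_def)
  have E: "edges I = {St_s} \<times> star_U M \<union> {(St_p, St_G)}"
    by (simp add: I star_instance_def)
  have cost_U: "cost I (St_s, u) = C - hU u" for u by (simp add: I star_instance_def)
  have cost_p: "cost I (St_p, St_G) = hU St_p" by (simp add: I star_instance_def)
  show pos: "\<forall>e\<in>edges I. 0 < cost I e"
    using h h[OF p] by (auto simp: E cost_U cost_p)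
  have heur_U: "heur I u = hU u" if "u \<in> star_U M" for u
    using that notU by (auto simp: I star_instance_def)
  have heur_sG: "heur I St_s = C" "heur I St_G = 0" by (simp_all add: I star_instance_def)
  have goals: "goals I = {St_G}" by (simp add: I star_instance_def)
  show "consistent I"
    unfolding consistent_def E goals using p by (auto simp: cost_U cost_p heur_U heur_sG)
  have S: "states I = {St_s, St_G} \<union> star_U M" "start I = St_s"
    by (simp_all add: I star_instance_def)
  have "distinct (succs I v) \<and> set (succs I v) = {w. (v, w) \<in> edges I}" for v
    unfolding E by (simp add: I star_instance_def us)
  moreover have "edges I \<subseteq> states I \<times> states I" unfolding E S using p by blast
  ultimately show "search_instance I"
    using pos fin by (simp add: search_instance_def S goals less_imp_le)
qed

lemma star_instances_tree:
  assumes "I \<in> star_instances M"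
  shows "\<forall>v\<in>states I. (start I, v) \<in> (edges I)\<^sup>*"
    "\<forall>v\<in>states I - {start I}. \<exists>!u. (u, v) \<in> edges I"
    "\<forall>u. (u, start I) \<notin> edges I"
proof -
  obtain C hU us where "I = star_instance M C hU us"
    using assms unfolding star_instances_def by blast
  then have E: "edges I = {St_s} \<times> star_U M \<union> {(St_p, St_G)}"
    and S: "states I = {St_s, St_G} \<union> star_U M" "start I = St_s"
    by (simp_all add: star_instance_def)
  have U: "(St_s, u) \<in> edges I" if "u \<in> star_U M" for u
    using that by (simp add: E)
  have p: "St_p \<in> star_U M" "(St_p, St_G) \<in> edges I" by (simp_all add: star_U_def E)
  have notU: "St_s \<notin> star_U M" "St_G \<notin> star_U M" by (auto simp: star_U_def)
  have "(St_s, St_G) \<in> (edges I)\<^sup>*"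
    by (rule rtrancl_into_rtrancl[OF r_into_rtrancl[OF U[OF p(1)]] p(2)])
  moreover have "(St_s, u) \<in> (edges I)\<^sup>*" if "u \<in> star_U M" for u
    by (rule r_into_rtrancl[OF U[OF that]])
  ultimately show "\<forall>v\<in>states I. (start I, v) \<in> (edges I)\<^sup>*"
    unfolding S by blast
  show "\<forall>v\<in>states I - {start I}. \<exists>!u. (u, v) \<in> edges I"
  proof
    fix v assume "v \<in> states I - {start I}"
    then consider "v = St_G" | "v \<in> star_U M" "v \<noteq> St_G" using notU by (auto simp: S)
    then show "\<exists>!u. (u, v) \<in> edges I"
    proof cases
      case 1
      show ?thesis using notU by (intro ex1I[of _ St_p]) (simp_all add: 1 E)
    next
      case 2
      then show ?thesis by (intro ex1I[of _ St_s]) (simp_all add: E)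
    qed
  qed
  show "\<forall>u. (u, start I) \<notin> edges I" using notU by (simp add: S E)
qed

end

theory Submission
  imports Defs
begin

text \<open>After \<open>s\<close> has been expanded, all states of \<open>U\<close> are on OPEN with the same value \<open>f = C\<close>, the
  \<open>b\<close>-states have no successors, and expanding \<open>p\<close> puts \<open>G\<close> on OPEN with \<open>f = C\<close>, which ends the
  search. So the number of expansions is \<open>2\<close> plus the number of \<open>b\<close>-states expanded before \<open>p\<close>.
  Making \<open>h(p)\<close> smaller than, larger than or equal to the common value of \<open>h\<close> on the \<open>b\<close>-states,
  and \<open>p\<close> the first or the last successor of \<open>s\<close>, one forces a strategy to expand \<open>p\<close> first
  or last, or leaves a uniformly random position to a RANDOM strategy.\<close>

section \<open>Selection\<close>

lemma arg_max_on_nat: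
  fixes f :: "'a \<Rightarrow> nat"
  assumes "finite S" "S \<noteq> {}"
  shows "arg_max_on f S \<in> S" and "x \<in> S \<Longrightarrow> f x \<le> f (arg_max_on f S)"
proof -
  \<comment> \<open>The facts on \<open>arg_max\<close> for natural values ask for a strict upper
    bound; finiteness of \<open>S\<close> supplies one, the successor of the largest value.\<close>
  have b: "\<forall>y. y \<in> S \<longrightarrow> f y < Suc (Max (f ` S))"
    using assms by (simp add: le_imp_less_Suc)
  obtain k where k: "k \<in> S" using assms by blast
  show "arg_max_on f S \<in> S"
    using arg_max_natI[of "\<lambda>x. x \<in> S", OF k b] by (simp add: arg_max_on_def)
  show "f x \<le> f (arg_max_on f S)" if "x \<in> S"
    using arg_max_nat_le[of "\<lambda>x. x \<in> S", OF that b] by (simp add: arg_max_on_def)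
qed

lemma set_base_select:
  assumes "finite S" "S \<noteq> {}"
  shows "set_pmf (base_select b \<sigma> S) \<subseteq> S"
  using assms arg_min_if_finite(1)[OF assms] arg_max_on_nat(1)[OF assms] by (cases b) auto

lemma base_select_singleton: "base_select b \<sigma> {v} = return_pmf v"
proof -
  have "set_pmf (base_select b \<sigma> {v}) \<subseteq> {v}" by (rule set_base_select) auto
  then show ?thesis by (simp add: set_pmf_subset_singleton)
qed

text \<open>\<open>arg_min_on\<close> picks some minimizer by choice; strictness makes the minimizer
  unique, so the choice is determined.\<close>

lemma base_select_FIFO_first:
  assumes "finite S" "v \<in> S" "\<And>w. w \<in> S - {v} \<Longrightarrow> stamp (entry \<sigma> v) < stamp (entry \<sigma> w)"
  shows "base_select FIFO \<sigma> S = return_pmf v"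
proof -
  have ne: "S \<noteq> {}" using assms by blast
  have "arg_min_on (\<lambda>v. stamp (entry \<sigma> v)) S = v"
    using arg_min_if_finite[OF assms(1) ne, of "\<lambda>v. stamp (entry \<sigma> v)"] assms(2,3) by blast
  then show ?thesis by simp
qed

lemma base_select_LIFO_first:
  assumes "finite S" "v \<in> S" "\<And>w. w \<in> S - {v} \<Longrightarrow> stamp (entry \<sigma> w) < stamp (entry \<sigma> v)"
  shows "base_select LIFO \<sigma> S = return_pmf v"
proof -
  have ne: "S \<noteq> {}" using assms by blast
  have "arg_max_on (\<lambda>v. stamp (entry \<sigma> v)) S = v"
    using arg_max_on_nat[OF assms(1) ne, where f = "\<lambda>v. stamp (entry \<sigma> v)"] assms(2,3)
    by (meson DiffI empty_iff insert_iff leD)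
  then show ?thesis by simp
qed

text \<open>One older competitor \<open>w\<close> rules \<open>v\<close> out, whichever minimizer is
  picked.\<close>

lemma base_select_FIFO_last:
  assumes "finite S" "w \<in> S" "stamp (entry \<sigma> w) < stamp (entry \<sigma> v)"
  shows "v \<notin> set_pmf (base_select FIFO \<sigma> S)"
proof -
  have ne: "S \<noteq> {}" using assms by blast
  show ?thesis
    using arg_min_if_finite[OF assms(1) ne, of "\<lambda>v. stamp (entry \<sigma> v)"] assms(2,3) by auto
qed

lemma base_select_LIFO_last:
  assumes "finite S" "w \<in> S" "stamp (entry \<sigma> v) < stamp (entry \<sigma> w)"
  shows "v \<notin> set_pmf (base_select LIFO \<sigma> S)"
proof -
  have ne: "S \<noteq> {}" using assms by blast
  show ?thesis
    using arg_max_on_nat[OF assms(1) ne, where f = "\<lambda>v. stamp (entry \<sigma> v)"] assms(2,3)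
    by (auto simp flip: not_le)
qed

text \<open>Every state in \<open>ws\<close> is fresh when its turn comes, distinctness keeping the
  tail fresh after each insertion. So every call inserts, and timestamps count up from
  \<open>clock \<sigma>\<close> in list order.\<close>

lemma fold_generate_new:
  fixes I :: "'v search_instance" and v :: 'v and gv :: real
  assumes "distinct ws" "set ws \<inter> (dom (OPEN \<sigma>) \<union> CLOSED \<sigma>) = {}"
  defines "\<sigma>' \<equiv> fold (generate I v gv) ws \<sigma>"
  shows "CLOSED \<sigma>' = CLOSED \<sigma>" "expansions \<sigma>' = expansions \<sigma>"
    "w \<notin> set ws \<Longrightarrow> OPEN \<sigma>' w = OPEN \<sigma> w"
    "i < length ws \<Longrightarrow> OPEN \<sigma>' (ws ! i) = Some \<lparr>gval = gv + cost I (v, ws ! i),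
       parent = Some v, stamp = clock \<sigma> + i, is_goal = (ws ! i \<in> goals I)\<rparr>"
proof -
  have "CLOSED (fold (generate I v gv) ws \<sigma>) = CLOSED \<sigma> \<and>
      expansions (fold (generate I v gv) ws \<sigma>) = expansions \<sigma> \<and>
      (\<forall>w. w \<notin> set ws \<longrightarrow> OPEN (fold (generate I v gv) ws \<sigma>) w = OPEN \<sigma> w) \<and>
      (\<forall>i<length ws. OPEN (fold (generate I v gv) ws \<sigma>) (ws ! i) =
        Some \<lparr>gval = gv + cost I (v, ws ! i), parent = Some v, stamp = clock \<sigma> + i,
          is_goal = (ws ! i \<in> goals I)\<rparr>)"
    using assms(1,2)
  proof (induction ws arbitrary: \<sigma>)
    case (Cons a ws)
    have a: "a \<notin> CLOSED \<sigma>" "OPEN \<sigma> a = None" using Cons.prems by auto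
    have g: "generate I v gv a \<sigma> =
       \<sigma>\<lparr>OPEN := (OPEN \<sigma>)(a \<mapsto> \<lparr>gval = gv + cost I (v, a), parent = Some v,
           stamp = clock \<sigma>, is_goal = (a \<in> goals I)\<rparr>), clock := Suc (clock \<sigma>)\<rparr>"
      using a by (simp add: generate_def)
    have p: "distinct ws" "set ws \<inter> (dom (OPEN (generate I v gv a \<sigma>)) \<union>
        CLOSED (generate I v gv a \<sigma>)) = {}" "a \<notin> set ws"
      using Cons.prems by (auto simp: g)
    note IH = Cons.IH[OF p(1,2)]
    show ?case
      using IH p(3) by (auto simp: g nth_Cons split: nat.splits)
  qed simp
  then show "CLOSED \<sigma>' = CLOSED \<sigma>" "expansions \<sigma>' = expansions \<sigma>"
    "w \<notin> set ws \<Longrightarrow> OPEN \<sigma>' w = OPEN \<sigma> w"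
    "i < length ws \<Longrightarrow> OPEN \<sigma>' (ws ! i) = Some \<lparr>gval = gv + cost I (v, ws ! i),
       parent = Some v, stamp = clock \<sigma> + i, is_goal = (ws ! i \<in> goals I)\<rparr>"
    unfolding \<sigma>'_def by blast+
qed

section \<open>Runs on a star instance\<close>

locale star =
  fixes M :: nat and C :: real and hU :: "star_state \<Rightarrow> real" and us :: "star_state list"
  assumes hU_bounds: "u \<in> star_U M \<Longrightarrow> 0 < hU u \<and> hU u < C"
    and distinct_us: "distinct us"
    and set_us: "set us = star_U M"
begin

section \<open>Basic facts about the star and the expansion of its root\<close>

abbreviation I :: "star_state search_instance" where
  "I \<equiv> star_instance M C hU us"

abbreviation U :: "star_state set" where
  "U \<equiv> star_U M"

lemma U_simps [simp]: "St_p \<in> U" "St_s \<notin> U" "St_G \<notin> U" "finite U" "card U = Suc M"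
proof -
  have "inj_on St_b {1..M}" by (auto simp: inj_on_def)
  then show "card U = Suc M"
    unfolding star_U_def by (subst card_insert_disjoint) (auto simp: card_image)
qed (auto simp: star_U_def)

lemma I_simps [simp]:
  "start I = St_s" "goals I = {St_G}" "succs I St_s = us" "succs I St_p = [St_G]"
  "cost I (St_s, u) = C - hU u" "cost I (St_p, u) = hU St_p"
  "heur I St_s = C" "heur I St_G = 0"
  by (simp_all add: star_instance_def)

lemma heur_U [simp]: "u \<in> U \<Longrightarrow> heur I u = hU u"
  by (auto simp: star_instance_def star_U_def)

lemma succs_b: "u \<in> U \<Longrightarrow> u \<noteq> St_p \<Longrightarrow> succs I u = []"
  by (auto simp: star_instance_def star_U_def)

lemma star_instances_I: "I \<in> star_instances M"
proof -
  have "0 < C" using hU_bounds[of St_p] by simp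
  then show ?thesis
    using hU_bounds distinct_us set_us unfolding star_instances_def by blast
qed

lemma search_instance_I: "search_instance I"
  using star_instances_sound(1)[OF star_instances_I] .

lemma card_states: "card (states I) = M + 3"
proof -
  have "states I = insert St_s (insert St_G U)" by (simp add: star_instance_def)
  then show ?thesis by simp
qed

text \<open>The configuration once \<open>s\<close> and exactly the \<open>b\<close>-states in
  \<open>S\<close> have been expanded. It depends only on the set: expanding a leaf just moves it
  from OPEN to CLOSED, so the order of these expansions leaves no trace. The \<open>Suc\<close>
  counts \<open>s\<close>.\<close>

definition after :: "star_state set \<Rightarrow> star_state config" where
  "after S = (expand I St_s (initial I))
     \<lparr>OPEN := OPEN (expand I St_s (initial I)) |` (- S),
      CLOSED := insert St_s S, expansions := Suc (card S)\<rparr>"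

lemma initial_simps:
  "OPEN (initial I) = [St_s \<mapsto> \<lparr>gval = 0, parent = None, stamp = 0, is_goal = False\<rparr>]"
  "CLOSED (initial I) = {}" "clock (initial I) = 1" "expansions (initial I) = 0"
  by (simp_all add: initial_def)

lemma expand_initial:
  "CLOSED (expand I St_s (initial I)) = {St_s}"
  "expansions (expand I St_s (initial I)) = 1"
  "w \<notin> U \<Longrightarrow> OPEN (expand I St_s (initial I)) w = None"
  "i < length us \<Longrightarrow> OPEN (expand I St_s (initial I)) (us ! i) = Some \<lparr>gval = C - hU (us ! i),
     parent = Some St_s, stamp = Suc i, is_goal = False\<rparr>"
proof -
  let ?\<sigma> = "initial I\<lparr>OPEN := (OPEN (initial I))(St_s := None),
     CLOSED := insert St_s (CLOSED (initial I)), expansions := Suc (expansions (initial I))\<rparr>"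
  have g: "gval (entry (initial I) St_s) = 0" by (simp add: entry_def initial_simps)
  have d: "set us \<inter> (dom (OPEN ?\<sigma>) \<union> CLOSED ?\<sigma>) = {}"
    using set_us by (auto simp: initial_simps)
  note f = fold_generate_new[OF distinct_us d, where I = I and v = St_s and gv = 0]
  have e: "expand I St_s (initial I) = fold (generate I St_s 0) us ?\<sigma>"
    by (simp add: expand_def g)
  show "CLOSED (expand I St_s (initial I)) = {St_s}"
    "expansions (expand I St_s (initial I)) = 1"
    "w \<notin> U \<Longrightarrow> OPEN (expand I St_s (initial I)) w = None"
    unfolding e using f(1,2,3) set_us by (simp_all add: initial_simps)
  have "us ! i \<noteq> St_G" if "i < length us"
    using that set_us nth_mem[OF that] by auto
  then show "i < length us \<Longrightarrow> OPEN (expand I St_s (initial I)) (us ! i) =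
     Some \<lparr>gval = C - hU (us ! i), parent = Some St_s, stamp = Suc i, is_goal = False\<rparr>"
    unfolding e using f(4) by (simp add: initial_simps)
qed

lemma after_empty: "after {} = expand I St_s (initial I)"
  using expand_initial(1,2)
  by (intro config.equality) (simp_all add: after_def restrict_map_def)

lemma after_simps [simp]:
  "CLOSED (after S) = insert St_s S" "expansions (after S) = Suc (card S)"
  by (simp_all add: after_def)

lemma dom_after [simp]: "dom (OPEN (after S)) = U - S"
proof -
  have "dom (OPEN (expand I St_s (initial I))) = U"
  proof (intro equalityI subsetI)
    fix w assume "w \<in> U"
    then obtain i where "i < length us" "w = us ! i"
      using set_us by (metis in_set_conv_nth)
    then show "w \<in> dom (OPEN (expand I St_s (initial I)))" using expand_initial(4) by blast
  qed (use expand_initial(3) in force)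
  then show ?thesis by (auto simp: after_def)
qed

lemma entry_after:
  assumes "i < length us" "us ! i \<notin> S"
  shows "entry (after S) (us ! i) = \<lparr>gval = C - hU (us ! i),
     parent = Some St_s, stamp = Suc i, is_goal = False\<rparr>"
  using assms expand_initial(4) by (simp add: entry_def after_def)

lemma entry_after_U:
  assumes "u \<in> U - S"
  shows "gval (entry (after S) u) = C - hU u" "\<not> is_goal (entry (after S) u)"
proof -
  obtain i where "i < length us" "u = us ! i" using assms set_us by (metis DiffD1 in_set_conv_nth)
  then show "gval (entry (after S) u) = C - hU u" "\<not> is_goal (entry (after S) u)"
    using entry_after[of i S] assms by auto
qed

text \<open>The edge cost \<open>C - hU u\<close> is chosen to cancel the heuristic, so all open
  states tie and only the tie-breaker decides.\<close>

lemma fval_after: "u \<in> U - S \<Longrightarrow> fval I (after S) u = C"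
  by (simp add: fval_def entry_after_U)

lemma open_min_after: "open_min I (after S) = U - S"
  by (auto simp: open_min_def fval_after)

lemma candidates_after: "candidates I (after S) = U - S"
  using entry_after_U by (auto simp: candidates_def open_min_after)

lemma not_finished_after: "St_p \<notin> S \<Longrightarrow> \<not> finished I (after S)"
  using entry_after_U U_simps(1) unfolding finished_def open_min_after dom_after by blast

text \<open>A \<open>b\<close>-state is a leaf, so the fold over its successors is empty.\<close>

lemma expand_b:
  assumes "S \<subseteq> U" "u \<in> U - S" "u \<noteq> St_p"
  shows "expand I u (after S) = after (insert u S)"
proof -
  \<comment> \<open>Finiteness is needed for \<open>card (insert u S)\<close> to exceed
    \<open>card S\<close> by one.\<close>
  have "finite S" using assms(1) by (rule finite_subset) simp
  moreover have "(OPEN (after S))(u := None) = OPEN (after (insert u S))"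
    by (auto simp: after_def restrict_map_def)
  ultimately show ?thesis
    using assms by (simp add: expand_def succs_b) (simp add: after_def insert_commute)
qed

text \<open>The goal gets \<open>g = (C - hU St_p) + hU St_p = C\<close> and has
  \<open>h = 0\<close>, so it ties with the remaining \<open>b\<close>-states and goal preference
  ends the search. The 2 counts \<open>s\<close> and \<open>p\<close>.\<close>

lemma expand_p:
  assumes "S \<subseteq> U - {St_p}"
  shows "finished I (expand I St_p (after S))"
    "expansions (expand I St_p (after S)) = card S + 2"
proof -
  let ?\<sigma> = "expand I St_p (after S)"
  have p: "St_p \<in> U - S" using assms by auto
  have no: "OPEN (after S) St_G = None" "St_G \<notin> insert St_p (insert St_s S)"
    using assms dom_after[of S] U_simps(3) by (blast, auto)
  have e: "OPEN ?\<sigma> = (OPEN (after S))(St_p := None, St_G \<mapsto>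
      \<lparr>gval = C, parent = Some St_p, stamp = clock (after S), is_goal = True\<rparr>)"
    "expansions ?\<sigma> = card S + 2"
    using no entry_after_U(1)[OF p] by (simp_all add: expand_def generate_def)
  then show "expansions ?\<sigma> = card S + 2" by simp
  have d: "dom (OPEN ?\<sigma>) = insert St_G (U - S - {St_p})"
    unfolding e using dom_after[of S] by auto
  have F: "fval I ?\<sigma> w = C" if "w \<in> dom (OPEN ?\<sigma>)" for w
  proof (cases "w = St_G")
    case False
    then have w: "w \<in> U - S" "w \<noteq> St_p" using that unfolding d by auto
    then have "entry ?\<sigma> w = entry (after S) w" using False by (simp add: entry_def e)
    then show ?thesis using w fval_after[OF w(1)] by (simp add: fval_def)
  qed (simp add: fval_def entry_def e)
  have G: "St_G \<in> dom (OPEN ?\<sigma>)" unfolding d by blast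
  have "St_G \<in> open_min I ?\<sigma>"
    unfolding open_min_def mem_Collect_eq
  proof (intro conjI ballI)
    fix w assume "w \<in> dom (OPEN ?\<sigma>)"
    from F[OF this] F[OF G] show "fval I ?\<sigma> St_G \<le> fval I ?\<sigma> w" by (simp only: order_refl)
  qed (rule G)
  moreover have "is_goal (entry ?\<sigma> St_G)" by (simp add: entry_def e)
  ultimately show "finished I ?\<sigma>" unfolding finished_def by blast
qed

section \<open>Configurations reachable by a run\<close>

lemma step_initial: "step \<tau> I (initial I) = return_pmf (after {})"
proof -
  have om: "open_min I (initial I) = {St_s}"
    by (auto simp: open_min_def initial_simps)
  have ng: "\<not> is_goal (entry (initial I) St_s)" by (simp add: entry_def initial_simps)
  have c: "candidates I (initial I) = {St_s}" using om ng by (auto simp: candidates_def)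
  have nf: "\<not> finished I (initial I)" using om ng by (auto simp: finished_def initial_simps)
  have "restrict_cands \<tau> (heur I) {St_s} = {St_s}" by (cases \<tau>) auto
  then have "select \<tau> I (initial I) = return_pmf St_s"
    by (simp add: select_def c base_select_singleton)
  then show ?thesis using nf by (simp add: step_def after_empty)
qed

lemma run_1: "run \<tau> I (Suc 0) = return_pmf (after {})"
  by (simp add: bind_return_pmf step_initial)

lemma step_after:
  assumes "St_p \<notin> S"
  shows "step \<tau> I (after S) = map_pmf (\<lambda>v. expand I v (after S)) (select \<tau> I (after S))"
  using not_finished_after[OF assms] by (simp add: step_def)

lemma set_select_after:
  assumes "St_p \<notin> S"
  shows "set_pmf (select \<tau> I (after S)) \<subseteq> U - S"
proof -
  have "finite (dom (OPEN (after S)))" by simp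
  from set_select[OF this not_finished_after[OF assms]] show ?thesis
    by (simp add: candidates_after)
qed

text \<open>Either only \<open>b\<close>-states have followed \<open>s\<close>, one per step, or
  \<open>p\<close> was selected at some earlier \<open>after S\<close> and the run has been frozen
  since, so that \<open>S\<close> may have any size. Keeping the fact that \<open>p\<close> was
  selectable there lets properties of the strategy constrain \<open>S\<close> later.\<close>

lemma run_support:
  assumes "\<sigma> \<in> set_pmf (run \<tau> I (Suc n))"
  obtains S where "S \<subseteq> U - {St_p}" "card S = n" "\<sigma> = after S"
  | S where "S \<subseteq> U - {St_p}" "St_p \<in> set_pmf (select \<tau> I (after S))"
      "\<sigma> = expand I St_p (after S)"
proof -
  have "(\<exists>S. S \<subseteq> U - {St_p} \<and> card S = n \<and> \<sigma> = after S) \<or>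
    (\<exists>S. S \<subseteq> U - {St_p} \<and> St_p \<in> set_pmf (select \<tau> I (after S)) \<and>
       \<sigma> = expand I St_p (after S))"
    using assms
  proof (induction n arbitrary: \<sigma>)
    case 0
    then have "\<sigma> = after {}" unfolding run_1 by simp
    then show ?case by (intro disjI1 exI[of _ "{}"]) simp
  next
    case (Suc n)
    obtain \<rho> where \<rho>: "\<rho> \<in> set_pmf (run \<tau> I (Suc n))" "\<sigma> \<in> set_pmf (step \<tau> I \<rho>)"
      \<comment> \<open>The instantiated recursion peels off only the last step and leaves
        \<open>run \<tau> I (Suc n)\<close> intact for the induction hypothesis.\<close>
      using Suc.prems unfolding run.simps(2)[of \<tau> I "Suc n"] set_bind_pmf by blast
    from Suc.IH[OF \<rho>(1)] show ?case
    proof (elim disjE exE conjE)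
      fix S assume S: "S \<subseteq> U - {St_p}" "card S = n" "\<rho> = after S"
      then have pS: "St_p \<notin> S" by blast
      obtain v where v: "v \<in> set_pmf (select \<tau> I (after S))" "\<sigma> = expand I v (after S)"
        using \<rho>(2) step_after[OF pS] S(3) by auto
      have vU: "v \<in> U - S" using set_select_after[OF pS] v(1) by blast
      show ?thesis
      proof (cases "v = St_p")
        case True
        then show ?thesis using S v by blast
      next
        case False
        have "finite S" using S(1) by (rule finite_subset) simp
        then have "card (insert v S) = Suc n" using vU S(2) by simp
        moreover have "\<sigma> = after (insert v S)" using v expand_b[of S v] S(1) vU False by blast
        moreover have "insert v S \<subseteq> U - {St_p}" using S(1) vU False by blast
        ultimately show ?thesis by blast
      qed
    next
      fix S assume S: "S \<subseteq> U - {St_p}" "St_p \<in> set_pmf (select \<tau> I (after S))"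
        "\<rho> = expand I St_p (after S)"
      then have "\<sigma> = \<rho>" using \<rho>(2) expand_p(1)[OF S(1)] by (simp add: step_def)
      then show ?thesis using S by blast
    qed
  qed
  then show ?thesis using that by blast
qed

text \<open>An unfinished configuration is the initial one or some \<open>after S\<close>, and
  \<open>G\<close> occurs in neither.\<close>

lemma decided: "decided_before_goal \<tau> I"
  unfolding decided_before_goal_def
proof (intro allI ballI impI)
  fix n \<sigma> assume s: "\<sigma> \<in> set_pmf (run \<tau> I n)" "\<not> finished I \<sigma>"
  show "goals I \<inter> (dom (OPEN \<sigma>) \<union> CLOSED \<sigma>) = {}"
  proof (cases n)
    case 0
    then show ?thesis using s(1) by (auto simp: initial_simps)
  next
    case (Suc k)
    from s(1)[unfolded Suc] show ?thesis
    proof (cases rule: run_support)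
      case (1 S)
      then show ?thesis by auto
    qed (use expand_p(1) s(2) in blast)
  qed
qed

lemma final_support:
  assumes "\<sigma> \<in> set_pmf (run \<tau> I (card (states I)))"
  obtains S where "S \<subseteq> U - {St_p}" "St_p \<in> set_pmf (select \<tau> I (after S))"
    "\<sigma> = expand I St_p (after S)"
proof -
  have "card (states I) = Suc (M + 2)" by (simp add: card_states)
  then have s: "\<sigma> \<in> set_pmf (run \<tau> I (Suc (M + 2)))" using assms by simp
  show ?thesis
  proof (rule run_support[OF s])
    \<comment> \<open>Of the \<open>M + 3\<close> steps the first expands \<open>s\<close>; the
      other \<open>M + 2\<close> cannot all go to \<open>b\<close>-states, of which there are only
      \<open>M\<close>.\<close>
    fix S assume "S \<subseteq> U - {St_p}" "card S = M + 2"
    moreover from this have "card S \<le> card (U - {St_p})" by (intro card_mono) auto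
    ultimately show ?thesis by simp
  qed (use that in blast)
qed

section \<open>Counts when \<open>p\<close> is forced to be first or last\<close>

lemma num_expanded_p_first:
  assumes "select \<tau> I (after {}) = return_pmf St_p"
  shows "num_expanded \<tau> I = return_pmf 2"
proof -
  have "run \<tau> I (n + 2) = return_pmf (expand I St_p (after {}))" for n
  proof (induction n)
    case 0
    show ?case using run_1[of \<tau>] step_after[of "{}" \<tau>] assms
      by (simp add: numeral_2_eq_2 bind_return_pmf)
  next
    case (Suc n)
    then show ?case using expand_p(1)[of "{}"] by (simp add: bind_return_pmf step_def)
  qed
  from this[of "M + 1"] show ?thesis
    using expand_p(2)[of "{}"] by (simp add: num_expanded_def card_states eval_nat_numeral)
qed

text \<open>As long as some \<open>b\<close>-state \<open>u\<close> is open, \<open>p\<close> cannot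
  be selected. Hence the set \<open>S\<close> expanded before \<open>p\<close> consists of all
  \<open>M\<close> \<open>b\<close>-states.\<close>

lemma num_expanded_p_last:
  assumes "\<And>S u. S \<subseteq> U - {St_p} \<Longrightarrow> u \<in> U - {St_p} - S \<Longrightarrow>
    St_p \<notin> set_pmf (select \<tau> I (after S))"
  shows "num_expanded \<tau> I = return_pmf (M + 2)"
proof -
  have "expansions \<sigma> = M + 2" if "\<sigma> \<in> set_pmf (run \<tau> I (card (states I)))" for \<sigma>
    using that
  proof (rule final_support)
    fix S assume S: "S \<subseteq> U - {St_p}" "St_p \<in> set_pmf (select \<tau> I (after S))"
      "\<sigma> = expand I St_p (after S)"
    then have "S = U - {St_p}" using assms by blast
    then show ?thesis using expand_p(2)[OF S(1)] S(3) by simp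
  qed
  then have "set_pmf (num_expanded \<tau> I) \<subseteq> {M + 2}" by (auto simp: num_expanded_def)
  then show ?thesis by (simp add: set_pmf_subset_singleton)
qed

section \<open>The mean count under uniform selection\<close>

lemma finite_set_run: "finite (set_pmf (run \<tau> I (Suc n)))"
proof (rule finite_subset)
  show "set_pmf (run \<tau> I (Suc n)) \<subseteq> after ` Pow U \<union> (\<lambda>S. expand I St_p (after S)) ` Pow U"
  proof
    fix \<sigma> assume "\<sigma> \<in> set_pmf (run \<tau> I (Suc n))"
    then show "\<sigma> \<in> after ` Pow U \<union> (\<lambda>S. expand I St_p (after S)) ` Pow U"
      by (rule run_support) blast+
  qed
qed simp

text \<open>The expected final number of expansions under uniform selection; \<open>(r + 1) / 2\<close> is the mean
  position of \<open>p\<close> among \<open>r\<close> open states.\<close>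

definition potential :: "star_state config \<Rightarrow> real" where
  "potential \<sigma> = real (expansions \<sigma>) +
     (if finished I \<sigma> then 0 else (real (card (dom (OPEN \<sigma>))) + 1) / 2)"

text \<open>The potential is a martingale. With \<open>r\<close> open states, \<open>p\<close> is
  drawn with probability \<open>1 / r\<close> and gives \<open>card S + 2\<close>; any other draw
  gives \<open>card S + 2 + r / 2\<close>. The mean is \<open>card S + 2 + (r - 1) / 2\<close>,
  which equals \<open>card S + 1 + (r + 1) / 2\<close>.\<close>

lemma potential_step:
  assumes "S \<subseteq> U - {St_p}" "select \<tau> I (after S) = pmf_of_set (U - S)"
  shows "measure_pmf.expectation (step \<tau> I (after S)) potential = potential (after S)"
proof -
  have p: "St_p \<in> U - S" using assms(1) U_simps(1) by blast
  then have pS: "St_p \<notin> S" and ne: "U - S \<noteq> {}" by blast+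
  have fin: "finite (U - S)" by simp
  have fS: "finite S" using assms(1) by (rule finite_subset) simp
  define r where "r = card (U - S)"
  have r: "r > 0" using fin ne by (simp add: r_def card_gt_0_iff)
  have pp: "potential (expand I St_p (after S)) = real (card S) + 2"
    using expand_p[OF assms(1)] by (simp add: potential_def)
  have pb: "potential (expand I v (after S)) = real (card S) + 2 + real r / 2"
    if v: "v \<in> U - S - {St_p}" for v
  proof -
    have e: "expand I v (after S) = after (insert v S)"
      using expand_b[of S v] assms(1) v by blast
    have "St_p \<notin> insert v S" using pS v by auto
    moreover have "U - insert v S = (U - S) - {v}" by blast
    moreover from this have "card (U - insert v S) = r - 1" using v fin by (simp add: r_def)
    ultimately show ?thesis
      using v fS r not_finished_after[of "insert v S"]
      by (simp add: e potential_def of_nat_diff field_simps)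
  qed
  have "(\<Sum>v\<in>U - S. potential (expand I v (after S))) =
      real (card S) + 2 + (\<Sum>v\<in>U - S - {St_p}. potential (expand I v (after S)))"
    using sum.remove[OF fin p, of "\<lambda>v. potential (expand I v (after S))"] pp by simp
  also have "\<dots> = real (card S) + 2 + (real r - 1) * (real (card S) + 2 + real r / 2)"
    using pb p fin r by (simp add: r_def[symmetric] of_nat_diff)
  finally have "measure_pmf.expectation (step \<tau> I (after S)) potential =
      (real (card S) + 2 + (real r - 1) * (real (card S) + 2 + real r / 2)) / real r"
    using fin ne by (simp add: step_after[OF pS] assms(2) integral_pmf_of_set r_def)
  also have "\<dots> = real (card S) + 1 + (real r + 1) / 2"
    using r by (simp add: field_simps)
  also have "\<dots> = potential (after S)"
    using not_finished_after[OF pS] by (simp add: potential_def r_def)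
  finally show ?thesis .
qed

text \<open>The mean potential keeps its value at \<open>after {}\<close>, which is
  \<open>1 + (M + 2) / 2\<close>. After \<open>card (states I)\<close> steps every run has finished,
  and there the potential is the number of expansions. Finite supports turn the expectations into
  finite sums.\<close>

lemma expected_expanded_uniform:
  assumes sel: "\<And>S. S \<subseteq> U - {St_p} \<Longrightarrow> select \<tau> I (after S) = pmf_of_set (U - S)"
  shows "expected_expanded \<tau> I = 2 + real M / 2"
proof -
  have E: "measure_pmf.expectation (run \<tau> I (Suc n)) potential = 2 + real M / 2" for n
  proof (induction n)
    case 0
    show ?case unfolding run_1
      using not_finished_after[of "{}"] by (simp add: potential_def field_simps)
  next
    case (Suc n)
    have st: "measure_pmf.expectation (step \<tau> I \<sigma>) potential = potential \<sigma>"
      "finite (set_pmf (step \<tau> I \<sigma>))"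
      if s: "\<sigma> \<in> set_pmf (run \<tau> I (Suc n))" for \<sigma>
    proof -
      show "measure_pmf.expectation (step \<tau> I \<sigma>) potential = potential \<sigma>"
        using s
      proof (cases rule: run_support)
        case (1 S)
        then show ?thesis using potential_step[OF _ sel] by blast
      next
        case (2 S)
        then show ?thesis using expand_p(1) by (simp add: step_def)
      qed
      have "set_pmf (step \<tau> I \<sigma>) \<subseteq> set_pmf (run \<tau> I (Suc (Suc n)))"
        unfolding run.simps(2)[of \<tau> I "Suc n"] set_bind_pmf
        using s by blast
      then show "finite (set_pmf (step \<tau> I \<sigma>))" using finite_set_run finite_subset by blast
    qed
    have "measure_pmf.expectation (run \<tau> I (Suc (Suc n))) potential =
      (\<Sum>\<sigma>\<in>set_pmf (run \<tau> I (Suc n)). pmf (run \<tau> I (Suc n)) \<sigma> *\<^sub>R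
         measure_pmf.expectation (step \<tau> I \<sigma>) potential)"
      unfolding run.simps(2)[of \<tau> I "Suc n"]
      by (rule pmf_expectation_bind[OF finite_set_run st(2)]) auto
    also have "\<dots> = (\<Sum>\<sigma>\<in>set_pmf (run \<tau> I (Suc n)). pmf (run \<tau> I (Suc n)) \<sigma> *\<^sub>R potential \<sigma>)"
      using st(1) by (intro sum.cong) simp_all
    also have "\<dots> = measure_pmf.expectation (run \<tau> I (Suc n)) potential"
      by (rule integral_measure_pmf[OF finite_set_run, symmetric]) auto
    finally show ?case using Suc by simp
  qed
  have "expected_expanded \<tau> I =
      measure_pmf.expectation (run \<tau> I (card (states I))) (\<lambda>\<sigma>. real (expansions \<sigma>))"
    by (simp add: expected_expanded_def num_expanded_def)
  also have "\<dots> = measure_pmf.expectation (run \<tau> I (card (states I))) potential"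
    using run_finished[OF search_instance_I]
    by (intro integral_cong_AE) (auto simp: AE_measure_pmf_iff potential_def)
  also have "\<dots> = 2 + real M / 2"
    using E[of "M + 2"] by (simp add: card_states eval_nat_numeral del: run.simps)
  finally show ?thesis .
qed

end

section \<open>The separating instances\<close>

definition b_list :: "nat \<Rightarrow> star_state list" where
  "b_list M = map St_b [1..<Suc M]"

definition us_of :: "nat \<Rightarrow> bool \<Rightarrow> star_state list" where
  "us_of M front = (if front then St_p # b_list M else b_list M @ [St_p])"

text \<open>All \<open>b\<close>-states share the value 2, so the values 1, 2, 3 for
  \<open>x\<close> put \<open>p\<close> below, level with or above them, inside the range given by
  \<open>C = 4\<close>.\<close>

definition h_of :: "real \<Rightarrow> star_state \<Rightarrow> real" where
  "h_of x = (\<lambda>v. if v = St_p then x else 2)"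

text \<open>\<open>place \<tau> x front\<close> is the (expected) fraction of the \<open>b\<close>-states expanded before \<open>p\<close>.\<close>

fun base_place :: "base_rule \<Rightarrow> bool \<Rightarrow> real" where
  "base_place FIFO front = (if front then 0 else 1)"
| "base_place LIFO front = (if front then 1 else 0)"
| "base_place RANDOM front = 1 / 2"

fun place :: "strategy \<Rightarrow> real \<Rightarrow> bool \<Rightarrow> real" where
  "place (Plain b) x front = base_place b front"
| "place (MinH b) x front = (if x < 2 then 0 else if x > 2 then 1 else base_place b front)"
| "place (MaxH b) x front = (if x > 2 then 0 else if x < 2 then 1 else base_place b front)"

locale separating_star =
  fixes M :: nat and x :: real and front :: bool
  assumes x: "0 < x" "x < 4"

sublocale separating_star \<subseteq> star M 4 "h_of x" "us_of M front"
proof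
  show "distinct (us_of M front)"
    by (auto simp: us_of_def b_list_def distinct_map inj_on_def)
  have "set (b_list M) = St_b ` {1..M}" by (auto simp: b_list_def)
  then show "set (us_of M front) = star_U M" by (auto simp: us_of_def star_U_def)
qed (use x in \<open>auto simp: h_of_def\<close>)

context separating_star
begin

text \<open>Position \<open>i\<close> in the successor list receives timestamp \<open>Suc i\<close>,
  and \<open>p\<close> sits at the front or behind all of \<open>b_list M\<close>.\<close>

lemma stamp_order:
  assumes "St_p \<notin> S" "u \<in> U - {St_p} - S"
  shows "if front then stamp (entry (after S) St_p) < stamp (entry (after S) u)
    else stamp (entry (after S) u) < stamp (entry (after S) St_p)"
proof -
  have "u \<in> set (b_list M)" using assms(2) set_us by (auto simp: us_of_def split: if_splits)
  then obtain i where i: "i < length (b_list M)" "u = b_list M ! i"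
    by (metis in_set_conv_nth)
  show ?thesis
  proof (cases front)
    case True
    then show ?thesis
      using entry_after[of 0 S] entry_after[of "Suc i" S] assms i by (simp add: us_of_def)
  next
    case False
    then show ?thesis
      using entry_after[of "length (b_list M)" S] entry_after[of i S] assms i
      by (simp add: us_of_def nth_append)
  qed
qed

lemma restrict_heur: "restrict_cands \<tau> (heur I) (U - S) = restrict_cands \<tau> (h_of x) (U - S)"
  by (cases \<tau>) auto

lemma restrict_all:
  assumes "S \<subseteq> U - {St_p}" "x = 2 \<or> \<tau> = Plain b"
  shows "restrict_cands \<tau> (heur I) (U - S) = U - S"
  using assms unfolding restrict_heur by (cases \<tau>) (auto simp: h_of_def)

text \<open>If the restriction by \<open>h\<close> is absent or all values of \<open>h\<close>
  agree, the base rule decides, via timestamps or a uniform draw. Otherwise the restriction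
  separates \<open>p\<close> from the \<open>b\<close>-states, which puts it first or last under
  every base rule.\<close>

lemma place_cases:
  obtains (first) "place \<tau> x front = 0" "select \<tau> I (after {}) = return_pmf St_p"
  | (last) "place \<tau> x front = 1" "\<And>S u. S \<subseteq> U - {St_p} \<Longrightarrow> u \<in> U - {St_p} - S \<Longrightarrow>
      St_p \<notin> set_pmf (select \<tau> I (after S))"
  | (uniform) "place \<tau> x front = 1 / 2"
      "\<And>S. S \<subseteq> U - {St_p} \<Longrightarrow> select \<tau> I (after S) = pmf_of_set (U - S)"
proof (cases "x = 2 \<or> (\<exists>b. \<tau> = Plain b)")
  case True
  have pl: "place \<tau> x front = base_place (base_of \<tau>) front"
    using True by (cases \<tau>) auto
  have sel: "select \<tau> I (after S) = base_select (base_of \<tau>) (after S) (U - S)"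
    if "S \<subseteq> U - {St_p}" for S
    using True restrict_all[OF that] by (auto simp: select_def candidates_after)
  have so: "stamp (entry (after S) St_p) < stamp (entry (after S) u) \<longleftrightarrow> front"
    "stamp (entry (after S) u) < stamp (entry (after S) St_p) \<longleftrightarrow> \<not> front"
    if "S \<subseteq> U - {St_p}" "u \<in> U - {St_p} - S" for S u
    using stamp_order[of S u] that by (cases front; force)+
  show ?thesis
  proof (cases "base_of \<tau>")
    case FIFO
    show ?thesis
    proof (cases front)
      case True
      then show ?thesis using FIFO pl sel[of "{}"] so[of "{}"]
          base_select_FIFO_first[of U St_p "after {}"]
        by (intro first) (simp_all del: base_select.simps)
    next
      case False
      show ?thesis
      proof (rule last)
        show "place \<tau> x front = 1" using pl FIFO \<open>\<not> front\<close> by simp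
        fix S u assume S: "S \<subseteq> U - {St_p}" "u \<in> U - {St_p} - S"
        show "St_p \<notin> set_pmf (select \<tau> I (after S))"
          unfolding sel[OF S(1)] FIFO
          by (rule base_select_FIFO_last[of _ u]) (use S so[OF S] \<open>\<not> front\<close> in simp_all)
      qed
    qed
  next
    case LIFO
    show ?thesis
    proof (cases front)
      case False
      then show ?thesis using LIFO pl sel[of "{}"] so[of "{}"]
          base_select_LIFO_first[of U St_p "after {}"]
        by (intro first) (simp_all del: base_select.simps)
    next
      case True
      show ?thesis
      proof (rule last)
        show "place \<tau> x front = 1" using pl LIFO \<open>front\<close> by simp
        fix S u assume S: "S \<subseteq> U - {St_p}" "u \<in> U - {St_p} - S"
        show "St_p \<notin> set_pmf (select \<tau> I (after S))"
          unfolding sel[OF S(1)] LIFO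
          by (rule base_select_LIFO_last[of _ u]) (use S so[OF S] \<open>front\<close> in simp_all)
      qed
    qed
  next
    case RANDOM
    then show ?thesis using pl sel by (intro uniform) simp_all
  qed
next
  case False
  let ?R = "\<lambda>S. restrict_cands \<tau> (h_of x) (U - S)"
  have sel: "select \<tau> I (after S) = base_select (base_of \<tau>) (after S) (?R S)" for S
    by (simp add: select_def candidates_after restrict_heur)
  \<comment> \<open>In case \<open>a\<close> the restricted set is the singleton of
    \<open>p\<close>; in case \<open>b\<close> it avoids \<open>p\<close> and contains every open
    \<open>b\<close>-state, hence is nonempty while one remains.\<close>
  from False consider
      (a) "place \<tau> x front = 0" "?R {} = {St_p}"
    | (b) "place \<tau> x front = 1"
        "\<And>S u. S \<subseteq> U - {St_p} \<Longrightarrow> u \<in> U - {St_p} - S \<Longrightarrow> St_p \<notin> ?R S \<and> u \<in> ?R S"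
  proof (cases \<tau>)
    case (MinH b)
    show ?thesis
    proof (cases "x < 2")
      case True
      then have "?R {} = {St_p}" by (auto simp: MinH h_of_def split: if_splits)
      then show ?thesis using True MinH a by simp
    next
      case F: False
      show ?thesis using False F by (intro b) (auto simp: MinH h_of_def split: if_splits)
    qed
  next
    case (MaxH b')
    show ?thesis
    proof (cases "x > 2")
      case True
      then have "?R {} = {St_p}" by (auto simp: MaxH h_of_def split: if_splits)
      then show ?thesis using True MaxH a by simp
    next
      case F: False
      show ?thesis using False F by (intro b) (auto simp: MaxH h_of_def split: if_splits)
    qed
  qed simp
  then show ?thesis
  proof cases
    case a
    then show ?thesis using sel[of "{}"] by (intro first) (simp_all add: base_select_singleton)
  next
    case b
    show ?thesis
    proof (rule last)
      fix S u assume "S \<subseteq> U - {St_p}" "u \<in> U - {St_p} - S"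
      note R = b(2)[OF this]
      have "?R S \<subseteq> U" by (cases \<tau>) auto
      then have "finite (?R S)" by (rule finite_subset) simp
      with R have "set_pmf (select \<tau> I (after S)) \<subseteq> ?R S"
        unfolding sel by (intro set_base_select) auto
      with R show "St_p \<notin> set_pmf (select \<tau> I (after S))" by blast
    qed (rule b(1))
  qed
qed

lemma num_expanded_place:
  "place \<tau> x front = 0 \<Longrightarrow> num_expanded \<tau> I = return_pmf 2"
  "place \<tau> x front = 1 \<Longrightarrow> num_expanded \<tau> I = return_pmf (M + 2)"
proof -
  show "num_expanded \<tau> I = return_pmf 2" if "place \<tau> x front = 0"
  proof (cases \<tau> rule: place_cases)
    case first
    then show ?thesis by (intro num_expanded_p_first)
  qed (use that in simp_all)
  show "num_expanded \<tau> I = return_pmf (M + 2)" if "place \<tau> x front = 1"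
  proof (cases \<tau> rule: place_cases)
    case last
    then show ?thesis by (intro num_expanded_p_last)
  qed (use that in simp_all)
qed

lemma expected_expanded_place: "expected_expanded \<tau> I = 2 + real M * place \<tau> x front"
proof (cases \<tau> rule: place_cases)
  case first
  then show ?thesis using num_expanded_place(1)[OF first(1)] by (simp add: expected_expanded_def)
next
  case last
  then show ?thesis using num_expanded_place(2)[OF last(1)] by (simp add: expected_expanded_def)
next
  case uniform
  then show ?thesis using expected_expanded_uniform[OF uniform(2)] by simp
qed

end

text \<open>With the same restriction the base rules differ, and \<open>x = 2\<close> lets
  \<open>front\<close> favour either one. For \<open>MinH\<close> against \<open>MaxH\<close>,
  \<open>x = 1\<close> and \<open>x = 3\<close> give the two outcomes. For a plain rule against a
  restricted one, \<open>x\<close> fixes the restricted strategy and \<open>front\<close> sets the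
  plain one to the opposite value.\<close>

lemma place_deterministic:
  assumes "deterministic \<tau>\<^sub>1" "deterministic \<tau>\<^sub>2" "\<tau>\<^sub>1 \<noteq> \<tau>\<^sub>2"
  shows "\<exists>x\<in>{1, 2, 3}. \<exists>front. place \<tau>\<^sub>1 x front = 0 \<and> place \<tau>\<^sub>2 x front = 1"
  using assms
  by (cases \<tau>\<^sub>1; cases \<tau>\<^sub>2; cases "base_of \<tau>\<^sub>1"; cases "base_of \<tau>\<^sub>2")
     (simp_all add: deterministic_def ex_bool_eq, auto)

text \<open>The same choices work; a RANDOM base rule that is left to decide has place
  \<open>1 / 2\<close>, and the other strategy can then be pushed to 0 or 1 as required.\<close>

lemma place_distinct:
  assumes "\<tau>\<^sub>1 \<noteq> \<tau>\<^sub>2"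
  shows "\<exists>x\<in>{1, 2, 3}. \<exists>front. place \<tau>\<^sub>2 x front - place \<tau>\<^sub>1 x front \<ge> 1 / 2"
  using assms
  by (cases \<tau>\<^sub>1; cases \<tau>\<^sub>2; cases "base_of \<tau>\<^sub>1"; cases "base_of \<tau>\<^sub>2")
     (simp_all add: ex_bool_eq, auto)

theorem theorem1:
  fixes M :: nat
  assumes "M \<ge> 1"
  shows
    "(\<forall>\<tau>\<^sub>1 \<tau>\<^sub>2. deterministic \<tau>\<^sub>1 \<and> deterministic \<tau>\<^sub>2 \<and> \<tau>\<^sub>1 \<noteq> \<tau>\<^sub>2 \<longrightarrow>
        (\<exists>I\<in>star_instances M.
           num_expanded \<tau>\<^sub>1 I = return_pmf 2 \<and> num_expanded \<tau>\<^sub>2 I = return_pmf (M + 2) \<and>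
           decided_before_goal \<tau>\<^sub>1 I \<and> decided_before_goal \<tau>\<^sub>2 I)) \<and>
     (\<forall>\<tau>\<^sub>1 \<tau>\<^sub>2. (randomized \<tau>\<^sub>1 \<or> randomized \<tau>\<^sub>2) \<and> \<tau>\<^sub>1 \<noteq> \<tau>\<^sub>2 \<longrightarrow>
        (\<exists>I\<in>star_instances M.
           expected_expanded \<tau>\<^sub>2 I - expected_expanded \<tau>\<^sub>1 I \<ge> real M / 2 \<and>
           decided_before_goal \<tau>\<^sub>1 I \<and> decided_before_goal \<tau>\<^sub>2 I))"
proof (intro conjI allI impI; elim conjE)
  fix \<tau>\<^sub>1 \<tau>\<^sub>2 :: strategy
  assume "deterministic \<tau>\<^sub>1" "deterministic \<tau>\<^sub>2" "\<tau>\<^sub>1 \<noteq> \<tau>\<^sub>2"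
  then obtain x front where x: "x \<in> {1, 2, 3 :: real}"
    and pl: "place \<tau>\<^sub>1 x front = 0" "place \<tau>\<^sub>2 x front = 1"
    using place_deterministic by blast
  interpret separating_star M x front by unfold_locales (use x in auto)
  show "\<exists>I\<in>star_instances M.
      num_expanded \<tau>\<^sub>1 I = return_pmf 2 \<and> num_expanded \<tau>\<^sub>2 I = return_pmf (M + 2) \<and>
      decided_before_goal \<tau>\<^sub>1 I \<and> decided_before_goal \<tau>\<^sub>2 I"
    by (intro bexI[OF _ star_instances_I] conjI decided num_expanded_place pl)
next
  fix \<tau>\<^sub>1 \<tau>\<^sub>2 :: strategy
  assume "\<tau>\<^sub>1 \<noteq> \<tau>\<^sub>2"
  then obtain x front where x: "x \<in> {1, 2, 3 :: real}"
    and pl: "place \<tau>\<^sub>2 x front - place \<tau>\<^sub>1 x front \<ge> 1 / 2"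
    using place_distinct by blast
  interpret separating_star M x front by unfold_locales (use x in auto)
  \<comment> \<open>The summand 2 for \<open>s\<close> and \<open>p\<close> cancels, leaving
    \<open>M\<close> times the gap between the places.\<close>
  have "expected_expanded \<tau>\<^sub>2 I - expected_expanded \<tau>\<^sub>1 I =
      real M * (place \<tau>\<^sub>2 x front - place \<tau>\<^sub>1 x front)"
    by (simp add: expected_expanded_place algebra_simps)
  also have "\<dots> \<ge> real M / 2"
    using mult_left_mono[OF pl, of "real M"] by simp
  finally have "expected_expanded \<tau>\<^sub>2 I - expected_expanded \<tau>\<^sub>1 I \<ge> real M / 2" .
  then show "\<exists>I\<in>star_instances M.
      expected_expanded \<tau>\<^sub>2 I - expected_expanded \<tau>\<^sub>1 I \<ge> real M / 2 \<and>
      decided_before_goal \<tau>\<^sub>1 I \<and> decided_before_goal \<tau>\<^sub>2 I"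
    by (intro bexI[OF _ star_instances_I] conjI decided)
qed

end
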